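(* For all integers $n\ge 1$ and $0\le\underline{k}\le\overline{k}$, the total number $t_{\underline{k}\le\overline{k}}(n)$ of ones contained in runs of ones with length in $[\underline{k},\overline{k}]$, over all binary strings of length $n$, is $$t_{\underline{k}\le\overline{k}}(n)=\big(n(\underline{k}+1)-\underline{k}(\underline{k}-1)\big)2^{n-(\underline{k}+1)}[\![\underline{k}\le n]\!]-\big(n(\overline{k}+2)-\overline{k}(\overline{k}+1)\big)2^{n-(\overline{k}+2)}[\![\overline{k}<n]\!].$$
   Context: $[\![P]\!]$ is the Iverson bracket ($1$ if $P$ is true, $0$ otherwise). A run of ones is a maximal block of consecutive ones, flanked on each side by a zero or by the start/end of the string; runs of length $0$ contain no ones and contribute nothing. *)

theory Defs
  imports Complex_Main
begin

text \<open>Binary strings are lists of type \<^typ>\<open>bool list\<close>, with \<^const>\<open>True\<close> read as the digit 1.\<close>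

text \<open>The block of positions \<open>i, \<dots>, i + l - 1\<close> of \<open>w\<close> is a run of ones. For \<open>l = 0\<close> this is the
  empty block between two adjacent zeros or string ends; it contains no position.\<close>

definition is_run :: "bool list \<Rightarrow> nat \<Rightarrow> nat \<Rightarrow> bool" where
  "is_run w i l \<longleftrightarrow>
     i + l \<le> length w \<and>
     (\<forall>j. i \<le> j \<and> j < i + l \<longrightarrow> w ! j) \<and>
     (i = 0 \<or> \<not> w ! (i - 1)) \<and>
     (i + l = length w \<or> \<not> w ! (i + l))"

definition ones_in_runs :: "nat \<Rightarrow> nat \<Rightarrow> bool list \<Rightarrow> nat" where
  "ones_in_runs kl ku w =
     card {j. j < length w \<and> w ! j \<and>
              (\<exists>i l. is_run w i l \<and> kl \<le> l \<and> l \<le> ku \<and> i \<le> j \<and> j < i + l)}"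

definition total_ones_in_runs :: "nat \<Rightarrow> nat \<Rightarrow> nat \<Rightarrow> nat" where
  "total_ones_in_runs kl ku n = (\<Sum>w | length w = n. ones_in_runs kl ku w)"

end

theory Submission
  imports Defs
begin

text \<open>
  Runs are maximal blocks, so the runs of a string are pairwise disjoint, and the number of ones
  lying in runs of length \<open>kl, \<dots>, ku\<close> is the sum of the lengths of these runs. Exchanging sums, the
  total is \<open>\<Sum>l=kl..ku. l * c l\<close>, where \<open>c l\<close> (\<open>run_count n l\<close>) is the number of pairs of a string of
  length \<open>n\<close> and a run of length \<open>l\<close> in it.

  That a given block is a run prescribes the digits of the block and of those neighbouring positions
  that exist, and leaves all others free (\<open>card_is_run\<close>). A block at one end of the string has one
  neighbour, an inner block has two; hence for \<open>0 < l < n\<close>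
  \<open>c l = 2 * 2 ^ (n - l - 1) + (n - l - 1) * 2 ^ (n - l - 2)\<close>, while \<open>c n = 1\<close>. With
  \<open>G k = (n * (k + 1) - k * (k - 1)) * 2 ^ (n - k - 1)\<close> for \<open>k \<le> n\<close> and \<open>G k = 0\<close> beyond, this gives
  \<open>l * c l = G l - G (l + 1)\<close> (\<open>run_length_count_eq_diff\<close>), so the sum telescopes to
  \<open>G kl - G (ku + 1)\<close>, the claimed formula.
\<close>

text \<open>Maximality: if one of two overlapping runs began or ended earlier, a delimiting zero of the
  other run would lie inside it.\<close>

lemma is_run_unique:
  assumes r: "is_run w i l" "is_run w i' l'"
    and j: "i \<le> j" "j < i + l" "i' \<le> j" "j < i' + l'"
  shows "i = i'" and "l = l'"
proof -
  have start: "b \<le> a" if "is_run w a m" "is_run w b m'" "b \<le> j" "j < a + m" for a b m m'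
  proof (rule ccontr)
    assume "\<not> b \<le> a"
    then have "a \<le> b - 1" "b - 1 < a + m" "b \<noteq> 0" using that by auto
    then show False using that unfolding is_run_def by blast
  qed
  have "i = i'" using start[OF r(1,2)] start[OF r(2,1)] j by simp
  moreover have stop: "a + m \<le> a + m'" if "is_run w a m" "is_run w a m'" for a m m'
  proof (rule ccontr)
    assume "\<not> a + m \<le> a + m'"
    then have "a + m' < a + m" "a + m' \<noteq> length w" using that unfolding is_run_def by auto
    then show False using that unfolding is_run_def by auto
  qed
  ultimately show "i = i'" "l = l'" using r by (auto intro: antisym)
qed

lemma finite_runs: "finite {(i, l). is_run w i l \<and> P i l}"
  by (rule finite_subset[of _ "{..length w} \<times> {..length w}"]) (auto simp: is_run_def)

text \<open>Distinct runs are disjoint, so the cardinality of their union is the sum of their lengths.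
  Indicators make the index set depend on \<open>w\<close> only through its length, which permits exchanging
  this sum with the one over all strings.\<close>

lemma ones_in_runs_eq_sum:
  "ones_in_runs kl ku w = (\<Sum>l=kl..ku. \<Sum>i\<le>length w. l * of_bool (is_run w i l))"
proof -
  let ?R = "{(i, l). is_run w i l \<and> kl \<le> l \<and> l \<le> ku}"
  have block: "j < length w \<and> w ! j" if "is_run w i l" "i \<le> j" "j < i + l" for i l j
    using that by (simp add: is_run_def)
  have "{j. j < length w \<and> w ! j \<and>
          (\<exists>i l. is_run w i l \<and> kl \<le> l \<and> l \<le> ku \<and> i \<le> j \<and> j < i + l)}
        = (\<Union>(i, l)\<in>?R. {i..<i + l})"
    using block by fastforce
  then have "ones_in_runs kl ku w = card (\<Union>(i, l)\<in>?R. {i..<i + l})"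
    by (simp add: ones_in_runs_def)
  also have "\<dots> = (\<Sum>p\<in>?R. card (case p of (i, l) \<Rightarrow> {i..<i + l}))"
  proof (rule card_UN_disjoint)
    show "\<forall>p\<in>?R. \<forall>q\<in>?R. p \<noteq> q \<longrightarrow>
        (case p of (i, l) \<Rightarrow> {i..<i + l}) \<inter> (case q of (i, l) \<Rightarrow> {i..<i + l}) = {}"
      using is_run_unique by fastforce
  qed (auto intro: finite_runs)
  also have "\<dots> = (\<Sum>(i, l)\<in>?R. l * of_bool (is_run w i l))"
    by (rule sum.cong) auto
  also have "\<dots> = (\<Sum>(i, l)\<in>{..length w} \<times> {kl..ku}. l * of_bool (is_run w i l))"
    by (rule sum.mono_neutral_left) (auto simp: is_run_def)
  also have "\<dots> = (\<Sum>l=kl..ku. \<Sum>i\<le>length w. l * of_bool (is_run w i l))"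
    by (subst sum.cartesian_product[symmetric]) (rule sum.swap)
  finally show ?thesis .
qed

lemma finite_bool_lists_length: "finite {w :: bool list. length w = n}"
  using finite_lists_length_eq[of "UNIV :: bool set" n] by simp

text \<open>Such a string corresponds to the set of its ones outside \<open>S\<close>, an arbitrary set of free
  positions.\<close>

lemma card_bool_lists_prescribed:
  fixes f :: "nat \<Rightarrow> bool"
  assumes "S \<subseteq> {..<n}"
  shows "card {w. length w = n \<and> (\<forall>j\<in>S. w ! j = f j)} = 2 ^ (n - card S)"
proof -
  have "bij_betw (\<lambda>A. map (\<lambda>j. if j \<in> S then f j else j \<in> A) [0..<n]) (Pow ({..<n} - S))
          {w. length w = n \<and> (\<forall>j\<in>S. w ! j = f j)}"
    by (rule bij_betw_byWitness[where f' = "\<lambda>w. {j\<in>{..<n} - S. w ! j}"])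
      (use assms in \<open>auto intro!: nth_equalityI split: if_splits\<close>)
  then have "card {w. length w = n \<and> (\<forall>j\<in>S. w ! j = f j)} = card (Pow ({..<n} - S))"
    by (simp add: bij_betw_same_card)
  also have "\<dots> = 2 ^ (n - card S)"
    using assms by (simp add: card_Pow card_Diff_subset finite_subset)
  finally show ?thesis .
qed

text \<open>The prescribed positions are the block and its neighbours, clipped to the string: truncated
  subtraction drops the left neighbour of a block at position 0, and \<open>min\<close> drops the right neighbour
  of a final block.\<close>

lemma card_is_run:
  assumes "i + l \<le> n"
  shows "card {w. length w = n \<and> is_run w i l} = 2 ^ (n - (min n (i + l + 1) - (i - 1)))"
proof -
  let ?S = "{i - 1..<min n (i + l + 1)}"
  have "is_run w i l \<longleftrightarrow> (\<forall>j\<in>?S. w ! j = (i \<le> j \<and> j < i + l))" (is "_ \<longleftrightarrow> ?R")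
    if "length w = n" for w
  proof
    assume r: "is_run w i l"
    show ?R
    proof
      fix j assume j: "j \<in> ?S"
      then consider "i \<le> j" "j < i + l" | "j = i - 1" "j < i" | "j = i + l" "j < n" by fastforce
      then show "w ! j = (i \<le> j \<and> j < i + l)"
        using r that by cases (auto simp: is_run_def)
    qed
  next
    assume ?R
    moreover have "i - 1 \<in> ?S" if "i \<noteq> 0" using that assms by auto
    moreover have "i + l \<in> ?S" if "i + l \<noteq> n" using that assms by auto
    ultimately show "is_run w i l"
      using assms that unfolding is_run_def by fastforce
  qed
  then have "{w. length w = n \<and> is_run w i l} =
      {w. length w = n \<and> (\<forall>j\<in>?S. w ! j = (i \<le> j \<and> j < i + l))}"
    by auto
  then have "card {w. length w = n \<and> is_run w i l} = 2 ^ (n - card ?S)"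
    by (simp only:) (rule card_bool_lists_prescribed, auto)
  then show ?thesis by simp
qed

lemma card_is_run_beyond:
  assumes "n < i + l"
  shows "card {w. length w = n \<and> is_run w i l} = 0"
proof -
  have "{w. length w = n \<and> is_run w i l} = {}"
    using assms by (auto simp: is_run_def)
  then show ?thesis by (metis card.empty)
qed

definition run_count :: "nat \<Rightarrow> nat \<Rightarrow> nat" where
  "run_count n l = (\<Sum>i\<le>n. card {w. length w = n \<and> is_run w i l})"

lemma total_ones_in_runs_eq_sum:
  "total_ones_in_runs kl ku n = (\<Sum>l=kl..ku. l * run_count n l)"
proof -
  let ?W = "{w :: bool list. length w = n}"
  have count: "(\<Sum>w\<in>?W. of_bool (is_run w i l)) = card {w. length w = n \<and> is_run w i l}" for i l
    using finite_bool_lists_length[of n] by (simp add: sum.If_cases of_bool_def Int_def)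
  have "total_ones_in_runs kl ku n
      = (\<Sum>w\<in>?W. \<Sum>l=kl..ku. \<Sum>i\<le>n. l * of_bool (is_run w i l))"
    by (simp add: total_ones_in_runs_def ones_in_runs_eq_sum)
  also have "\<dots> = (\<Sum>l=kl..ku. \<Sum>w\<in>?W. \<Sum>i\<le>n. l * of_bool (is_run w i l))"
    by (rule sum.swap)
  also have "\<dots> = (\<Sum>l=kl..ku. \<Sum>i\<le>n. \<Sum>w\<in>?W. l * of_bool (is_run w i l))"
    by (intro sum.cong refl sum.swap)
  also have "\<dots> = (\<Sum>l=kl..ku. l * run_count n l)"
    unfolding run_count_def sum_distrib_left[symmetric] count ..
  finally show ?thesis .
qed

lemma run_count_eq_sum:
  assumes "l \<le> n"
  shows "run_count n l = (\<Sum>i\<le>n - l. 2 ^ (n - (min n (i + l + 1) - (i - 1))))"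
proof -
  have "run_count n l = (\<Sum>i\<le>n - l. card {w. length w = n \<and> is_run w i l})"
    unfolding run_count_def
  proof (rule sum.mono_neutral_right)
    show "\<forall>i\<in>{..n} - {..n - l}. card {w. length w = n \<and> is_run w i l} = 0"
      by (intro ballI card_is_run_beyond) auto
  qed auto
  also have "\<dots> = (\<Sum>i\<le>n - l. 2 ^ (n - (min n (i + l + 1) - (i - 1))))"
    by (intro sum.cong refl card_is_run) (use assms in auto)
  finally show ?thesis .
qed

lemma run_count_greater: "n < l \<Longrightarrow> run_count n l = 0"
  by (auto simp: run_count_def card_is_run_beyond)

lemma run_count_self: "run_count n n = 1"
  by (simp add: run_count_eq_sum)

text \<open>The two end positions \<open>i = 0\<close> and \<open>i = m + 1\<close> contribute \<open>2 ^ m\<close> strings each, and each of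
  the \<open>m\<close> inner ones half as many. Multiplying by 2 avoids a truncated exponent when \<open>m = 0\<close>.\<close>

lemma run_count_less: "2 * run_count (l + 1 + m) l = (m + 4) * 2 ^ m"
proof -
  let ?g = "\<lambda>i. 2 ^ (l + 1 + m - (min (l + 1 + m) (i + l + 1) - (i - 1))) :: nat"
  have "run_count (l + 1 + m) l = (\<Sum>i\<le>Suc m. ?g i)"
    by (subst run_count_eq_sum) auto
  also have "\<dots> = ?g 0 + (\<Sum>i<m. ?g (Suc i)) + ?g (Suc m)"
    by (subst sum.atMost_Suc, subst sum.atMost_shift) (rule refl)
  also have "(\<Sum>i<m. ?g (Suc i)) = (\<Sum>i<m. 2 ^ (m - 1))"
    by (rule sum.cong) (auto intro!: arg_cong[where f = "\<lambda>e. 2 ^ e"])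
  finally show ?thesis
    by (cases m) (auto simp: algebra_simps)
qed

text \<open>By the telescoping below, the total number of ones in runs of length at least \<open>k\<close>.\<close>

definition ones_in_long_runs :: "nat \<Rightarrow> nat \<Rightarrow> real" where
  "ones_in_long_runs n k =
     (real n * (real k + 1) - real k * (real k - 1))
       * 2 powi (int n - (int k + 1)) * of_bool (k \<le> n)"

text \<open>For \<open>l < n\<close> put \<open>m = n - l - 1\<close>: the powers of 2 on the right are \<open>2 ^ m\<close> and \<open>2 ^ m / 2\<close>, and
  the claim reduces to \<open>l * (m + 4) = 2 * (n * (l + 1) - l * (l - 1)) - (n * (l + 2) - (l + 1) * l)\<close>.\<close>

lemma run_length_count_eq_diff:
  assumes "n \<ge> 1"
  shows "real (l * run_count n l) = ones_in_long_runs n l - ones_in_long_runs n (Suc l)"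
proof -
  consider "n < l" | "n = l" | m where "n = l + 1 + m"
    by (metis less_iff_Suc_add linorder_neqE_nat Suc_eq_plus1 add.assoc add.commute)
  then show ?thesis
  proof cases
    case 1
    then show ?thesis by (simp add: run_count_greater ones_in_long_runs_def)
  next
    case 2
    then show ?thesis
      by (simp add: run_count_self ones_in_long_runs_def power_int_minus algebra_simps)
  next
    case (3 m)
    have "2 * real (run_count n l) = (real m + 4) * 2 ^ m"
      using arg_cong[OF run_count_less[of l m], of real] 3 by simp
    then have count: "real (run_count n l) = (real m + 4) * 2 ^ m / 2" by simp
    have e1: "(2::real) powi (int n - (int l + 1)) = 2 ^ m"
      using 3 by simp
    have e2: "(2::real) powi (int n - (int (Suc l) + 1)) = 2 ^ m / 2"
      using 3 by (simp add: power_int_diff)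
    show ?thesis
      unfolding ones_in_long_runs_def e1 e2 of_nat_mult count using 3
      by (simp add: field_simps)
  qed
qed

theorem mainTheorem20:
  fixes n kl ku :: nat
  assumes "n \<ge> 1" and "kl \<le> ku"
  shows "real (total_ones_in_runs kl ku n) =
      (real n * (real kl + 1) - real kl * (real kl - 1))
        * 2 powi (int n - (int kl + 1)) * of_bool (kl \<le> n)
    - (real n * (real ku + 2) - real ku * (real ku + 1))
        * 2 powi (int n - (int ku + 2)) * of_bool (ku < n)"
proof -
  have "real (total_ones_in_runs kl ku n)
      = (\<Sum>l=kl..ku. ones_in_long_runs n l - ones_in_long_runs n (Suc l))"
    unfolding total_ones_in_runs_eq_sum of_nat_sum
    using assms(1) by (intro sum.cong refl run_length_count_eq_diff)
  also have "\<dots> = - (\<Sum>l=kl..ku. ones_in_long_runs n (Suc l) - ones_in_long_runs n l)"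
    by (simp add: sum_negf[symmetric])
  also have "\<dots> = ones_in_long_runs n kl - ones_in_long_runs n (Suc ku)"
    using assms(2) by (simp add: sum_Suc_diff)
  finally show ?thesis
    by (simp add: ones_in_long_runs_def Suc_le_eq algebra_simps)
qed

end
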